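(* Every positive regular number is reordered computable.
   Context: $\mathbb{N}=\{0,1,2,\dots\}$. A real number in $[0,1]$ is strongly left-computable if it equals $\sum_{n\in A}2^{-(n+1)}$ for some computably enumerable set $A\subseteq\mathbb{N}$. A real number is regular if it is a sum of finitely many strongly left-computable numbers. A function $f\colon\mathbb{N}\to\mathbb{N}$ tends to infinity if for every $c$ there is $m$ with $f(n)>c$ for all $n\ge m$. For such $f$, $u_f(n) := |\{k\in\mathbb{N} \mid f(k)=n\}|$. A function $f\colon\mathbb{N}\to\mathbb{N}$ is a name for a real number $x$ if $\sum_{k=0}^\infty 2^{-f(k)} = x$ (then $f$ tends to infinity). A convergent sequence $(x_n)_n$ with limit $x$ converges computably if there is a computable $s\colon\mathbb{N}\to\mathbb{N}$ with $|x-x_k|\le 2^{-n}$ for all $n$ and all $k\ge s(n)$; a series converges computably if the sequence of its partial sums $\left(\sum_{k=0}^{n-1}a_k\right)_n$ does (no computability of the terms is required). A real number is reordered computable if it has a computable name $f$ such that $\sum_{k=0}^\infty u_f(k)\cdot 2^{-k}$ converges computably. *)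

theory Defs
  imports "HOL-Analysis.Analysis"
begin

text \<open>
  Computability is formalized by partial recursive functions: a program acts on argument
  lists, and \<open>rec_eval r xs y\<close> holds iff \<open>r\<close> halts on \<open>xs\<close> with output \<open>y\<close>.
  In \<open>Prim_Rec\<close> the recursion variable comes first, followed in the step function by the
  previous value; in \<open>Mu\<close> the search variable comes first, and all values of the searched
  function before its first zero have to be defined.
\<close>

datatype rec_prog =
    Zero
  | Succ
  | Proj nat
  | Comp rec_prog "rec_prog list"
  | Prim_Rec rec_prog rec_prog
  | Mu rec_prog

inductive rec_eval :: "rec_prog \<Rightarrow> nat list \<Rightarrow> nat \<Rightarrow> bool" where
  Zero: "rec_eval Zero xs 0"
| Succ: "rec_eval Succ [x] (Suc x)"
| Proj: "i < length xs \<Longrightarrow> rec_eval (Proj i) xs (xs ! i)"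
| Comp: "list_all2 (\<lambda>g y. rec_eval g xs y) gs ys \<Longrightarrow> rec_eval f ys z \<Longrightarrow>
         rec_eval (Comp f gs) xs z"
| Prim_Rec_0: "rec_eval f xs y \<Longrightarrow> rec_eval (Prim_Rec f g) (0 # xs) y"
| Prim_Rec_Suc: "rec_eval (Prim_Rec f g) (n # xs) y \<Longrightarrow> rec_eval g (n # y # xs) z \<Longrightarrow>
         rec_eval (Prim_Rec f g) (Suc n # xs) z"
| Mu: "rec_eval f (n # xs) 0 \<Longrightarrow> (\<forall>m<n. \<exists>y. rec_eval f (m # xs) (Suc y)) \<Longrightarrow>
         rec_eval (Mu f) xs n"

lemma rec_eval_deterministic: "rec_eval r xs y \<Longrightarrow> rec_eval r xs z \<Longrightarrow> z = y"
proof (induction arbitrary: z rule: rec_eval.induct)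
  case (Zero xs)
  then show ?case by cases
next
  case (Succ x)
  then show ?case by cases
next
  case (Proj i xs)
  from Proj(2) show ?case by cases
next
  case (Comp xs gs ys f z z')
  from Comp(4) show ?case
  proof cases
    case (Comp ys')
    have "ys' = ys"
      by (rule nth_equalityI) (use Comp \<open>list_all2 _ gs ys\<close> in \<open>auto simp: list_all2_conv_all_nth\<close>)
    with Comp(2) \<open>\<And>z. rec_eval f ys z \<Longrightarrow> z = _\<close> show ?thesis by simp
  qed
next
  case (Prim_Rec_0 f xs y g)
  from Prim_Rec_0(3) show ?case by cases (auto intro: Prim_Rec_0(2))
next
  case (Prim_Rec_Suc f g n xs y z z')
  from Prim_Rec_Suc(5) show ?case
    by cases (use Prim_Rec_Suc(3,4) in blast)
next
  case (Mu f n xs k)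
  from Mu(4) show ?case
  proof cases
    case k: Mu
    have "\<not> n < k" using k(2) Mu(2) by (metis nat.distinct(1))
    moreover have "\<not> k < n" using k(1) Mu(3) by (metis nat.distinct(1))
    ultimately show ?thesis by simp
  qed
qed

definition computable :: "(nat \<Rightarrow> nat) \<Rightarrow> bool" where
  "computable f \<longleftrightarrow> (\<exists>r. \<forall>x. rec_eval r [x] (f x))"

definition computably_enumerable :: "nat set \<Rightarrow> bool" where
  "computably_enumerable A \<longleftrightarrow> A = {} \<or> (\<exists>f. computable f \<and> A = range f)"

definition strongly_left_computable :: "real \<Rightarrow> bool" where
  "strongly_left_computable x \<longleftrightarrow> x \<in> {0..1} \<and>
     (\<exists>A. computably_enumerable A \<and> ((\<lambda>n. 1 / 2 ^ (n + 1)) has_sum x) A)"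

definition regular_real :: "real \<Rightarrow> bool" where
  "regular_real x \<longleftrightarrow>
     (\<exists>ys. (\<forall>y\<in>set ys. strongly_left_computable y) \<and> x = sum_list ys)"

definition is_name :: "(nat \<Rightarrow> nat) \<Rightarrow> real \<Rightarrow> bool" where
  "is_name f x \<longleftrightarrow> (\<lambda>k. 1 / 2 ^ f k) sums x"

definition multiplicity_fun :: "(nat \<Rightarrow> nat) \<Rightarrow> nat \<Rightarrow> nat" where
  "multiplicity_fun f n = card {k. f k = n}"

text \<open>
  Since \<open>card\<close> is \<open>0\<close> on infinite sets, \<open>multiplicity_fun f\<close> is meaningful only if all
  fibres of \<open>f\<close> are finite. This is the case for names, because they tend to infinity.
\<close>

lemma is_name_tends_to_infinity:
  assumes "is_name f x"
  shows "filterlim f at_top at_top"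
  unfolding filterlim_at_top
proof
  fix c
  have "(\<lambda>k. 1 / 2 ^ f k :: real) \<longlonglongrightarrow> 0"
    using assms unfolding is_name_def by (intro summable_LIMSEQ_zero sums_summable)
  then have "\<forall>\<^sub>F k in sequentially. 1 / 2 ^ f k < (1 / 2 ^ c :: real)"
    by (rule order_tendstoD) simp
  then show "\<forall>\<^sub>F k in sequentially. c \<le> f k"
    by eventually_elim (simp add: field_simps)
qed

lemma is_name_finite_fibre:
  assumes "is_name f x"
  shows "finite {k. f k = n}"
proof -
  have "\<forall>\<^sub>F k in sequentially. Suc n \<le> f k"
    using is_name_tends_to_infinity[OF assms] unfolding filterlim_at_top by blast
  then obtain m where "\<forall>k\<ge>m. Suc n \<le> f k"
    unfolding eventually_sequentially by blast
  then have "{k. f k = n} \<subseteq> {..<m}"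
    by (metis (mono_tags) Suc_n_not_le_n lessThan_iff mem_Collect_eq not_le subsetI)
  then show ?thesis by (rule finite_subset) simp
qed

definition converges_computably :: "(nat \<Rightarrow> real) \<Rightarrow> bool" where
  "converges_computably X \<longleftrightarrow>
     (\<exists>x. X \<longlonglongrightarrow> x \<and>
       (\<exists>s. computable s \<and> (\<forall>n. \<forall>k\<ge>s n. \<bar>x - X k\<bar> \<le> 1 / 2 ^ n)))"

definition series_converges_computably :: "(nat \<Rightarrow> real) \<Rightarrow> bool" where
  "series_converges_computably a \<longleftrightarrow> converges_computably (\<lambda>n. \<Sum>k<n. a k)"

definition reordered_computable :: "real \<Rightarrow> bool" where
  "reordered_computable x \<longleftrightarrow>
     (\<exists>f. computable f \<and> is_name f x \<and>
        series_converges_computably (\<lambda>k. real (multiplicity_fun f k) * (1 / 2 ^ k)))"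

end

theory Submission
  imports Defs
begin

text \<open>
  The key notion is that of a computable name \<open>f\<close> taking each value at most \<open>c\<close> times. For such
  a name the tail \<open>\<Sum>k\<ge>n. u\<^sub>f(k) * 2^(-k)\<close> is at most \<open>2 * c * 2^(-n)\<close>, so the multiplicity series
  converges with a computable (even linear) modulus, and the number named is reordered computable
  (\<open>bounded_name_imp_reordered_computable\<close>). It therefore suffices to find such names, and the
  numbers that have one are closed under addition: interleaving two names adds the numbers and at
  most adds the bounds (\<open>bounded_name_add\<close>).

  A strongly left-computable number given by an infinite computably enumerable set \<open>A\<close> has a name
  with bound \<open>1\<close>, because an infinite computably enumerable set has an injective computable
  enumeration (\<open>injective_enumeration\<close>). If \<open>A\<close> is finite, its enumeration cannot be
  injective; but then the number is a finite sum of powers \<open>2^(-n)\<close>, and each of these is the infinite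
  sum \<open>2^(-n-1) + 2^(-n-2) + \<dots>\<close>, which again is a name with bound \<open>1\<close>. Only an empty sum, the
  number \<open>0\<close>, has no name, which is where positivity enters.
\<close>

section \<open>Closure properties of recursive functions\<close>

text \<open>
  Functions of several arguments are represented as functions on argument lists of a fixed length,
  so that the closure properties below apply to a term with free argument places by following its
  structure.
\<close>

definition recursive :: "nat \<Rightarrow> (nat list \<Rightarrow> nat) \<Rightarrow> bool" where
  "recursive n F \<longleftrightarrow> (\<exists>r. \<forall>xs. length xs = n \<longrightarrow> rec_eval r xs (F xs))"

lemma recursiveI: "(\<And>xs. length xs = n \<Longrightarrow> rec_eval r xs (F xs)) \<Longrightarrow> recursive n F"
  unfolding recursive_def by blast

lemma recursive_cong:
  assumes "recursive n F" and "\<And>xs. length xs = n \<Longrightarrow> F xs = G xs"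
  shows "recursive n G"
  using assms unfolding recursive_def by metis

lemma computable_iff_recursive: "computable f \<longleftrightarrow> recursive 1 (\<lambda>xs. f (xs ! 0))"
proof -
  have "(\<forall>xs. length xs = 1 \<longrightarrow> rec_eval r xs (f (xs ! 0))) \<longleftrightarrow> (\<forall>x. rec_eval r [x] (f x))" for r
    by (auto simp: length_Suc_conv)
  then show ?thesis unfolding computable_def recursive_def by simp
qed

lemma recursive_nth: "i < n \<Longrightarrow> recursive n (\<lambda>xs. xs ! i)"
  by (rule recursiveI[where r = "Proj i"]) (auto intro: rec_eval.Proj)

lemma recursive_comp:
  assumes F: "recursive (length Gs) F" and Gs: "\<And>G. G \<in> set Gs \<Longrightarrow> recursive n G"
  shows "recursive n (\<lambda>xs. F (map (\<lambda>G. G xs) Gs))"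
proof -
  obtain f where f: "\<And>ys. length ys = length Gs \<Longrightarrow> rec_eval f ys (F ys)"
    using F unfolding recursive_def by blast
  obtain g where g: "\<And>G xs. G \<in> set Gs \<Longrightarrow> length xs = n \<Longrightarrow> rec_eval (g G) xs (G xs)"
    using Gs unfolding recursive_def by metis
  show ?thesis
  proof (rule recursiveI)
    fix xs :: "nat list"
    assume "length xs = n"
    then have "list_all2 (\<lambda>h y. rec_eval h xs y) (map g Gs) (map (\<lambda>G. G xs) Gs)"
      by (auto simp: list_all2_conv_all_nth intro!: g)
    then show "rec_eval (Comp f (map g Gs)) xs (F (map (\<lambda>G. G xs) Gs))"
      by (rule rec_eval.Comp) (simp add: f)
  qed
qed

lemma recursive_computable:
  assumes "computable f" and "recursive n G"
  shows "recursive n (\<lambda>xs. f (G xs))"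
  using recursive_comp[of "[G]" "\<lambda>xs. f (xs ! 0)" n] assms by (simp add: computable_iff_recursive)

lemma recursive_drop:
  assumes "recursive n F"
  shows "recursive (n + k) (\<lambda>xs. F (drop k xs))"
proof -
  let ?Gs = "map (\<lambda>i xs. xs ! (k + i)) [0..<n] :: (nat list \<Rightarrow> nat) list"
  have "recursive (n + k) (\<lambda>xs. F (map (\<lambda>G. G xs) ?Gs))"
    by (rule recursive_comp) (use assms in \<open>auto intro: recursive_nth\<close>)
  then show ?thesis
  proof (rule recursive_cong)
    fix xs :: "nat list"
    assume "length xs = n + k"
    then have "map (\<lambda>G. G xs) ?Gs = drop k xs"
      by (intro nth_equalityI) auto
    then show "F (map (\<lambda>G. G xs) ?Gs) = F (drop k xs)" by simp
  qed
qed

text \<open>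
  Recursion with parameters \<open>xs\<close>, composed with a recursive number of steps: in this form the lemma
  yields every arithmetic function below as soon as it is written with \<open>rec_nat\<close>.
\<close>

lemma recursive_rec_nat:
  assumes F: "recursive n F" and G: "recursive (n + 2) G" and H: "recursive n H"
  shows "recursive n (\<lambda>xs. rec_nat (F xs) (\<lambda>m y. G (m # y # xs)) (H xs))"
proof -
  obtain f where f: "\<And>xs. length xs = n \<Longrightarrow> rec_eval f xs (F xs)"
    using F unfolding recursive_def by blast
  obtain g where g: "\<And>xs. length xs = n + 2 \<Longrightarrow> rec_eval g xs (G xs)"
    using G unfolding recursive_def by blast
  obtain h where h: "\<And>xs. length xs = n \<Longrightarrow> rec_eval h xs (H xs)"
    using H unfolding recursive_def by blast
  show ?thesis
  proof (rule recursiveI)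
    fix xs :: "nat list"
    assume len: "length xs = n"
    have "list_all2 (\<lambda>q y. rec_eval q xs y) (map Proj [0..<n]) xs"
      using len by (auto simp: list_all2_conv_all_nth intro: rec_eval.Proj)
    then have args: "list_all2 (\<lambda>q y. rec_eval q xs y) (h # map Proj [0..<n]) (H xs # xs)"
      using h[OF len] by simp
    have "rec_eval (Prim_Rec f g) (m # xs) (rec_nat (F xs) (\<lambda>m y. G (m # y # xs)) m)" for m
      by (induction m) (auto intro!: rec_eval.Prim_Rec_0 rec_eval.Prim_Rec_Suc f g simp: len)
    with args show "rec_eval (Comp (Prim_Rec f g) (h # map Proj [0..<n])) xs
        (rec_nat (F xs) (\<lambda>m y. G (m # y # xs)) (H xs))"
      by (rule rec_eval.Comp)
  qed
qed

lemma recursive_Least: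
  assumes F: "recursive (Suc n) F" and ex: "\<And>xs. length xs = n \<Longrightarrow> \<exists>k. F (k # xs) = 0"
  shows "recursive n (\<lambda>xs. LEAST k. F (k # xs) = 0)"
proof -
  obtain f where f: "\<And>xs. length xs = Suc n \<Longrightarrow> rec_eval f xs (F xs)"
    using F unfolding recursive_def by blast
  show ?thesis
  proof (rule recursiveI)
    fix xs :: "nat list"
    assume len: "length xs = n"
    let ?k = "LEAST k. F (k # xs) = 0"
    have "F (?k # xs) = 0" using ex[OF len] by (rule LeastI_ex)
    then have "rec_eval f (?k # xs) 0" using f[of "?k # xs"] len by simp
    moreover have "\<exists>y. rec_eval f (m # xs) (Suc y)" if "m < ?k" for m
      using f[of "m # xs"] len not_less_Least[OF that] by (metis length_Cons not0_implies_Suc)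
    ultimately show "rec_eval (Mu f) xs ?k" by (intro rec_eval.Mu) auto
  qed
qed

lemma recursive_Suc:
  assumes "recursive n F"
  shows "recursive n (\<lambda>xs. Suc (F xs))"
proof -
  have "computable Suc" unfolding computable_def by (auto intro: rec_eval.Succ)
  then show ?thesis using assms by (rule recursive_computable)
qed

lemma recursive_const: "recursive n (\<lambda>xs. c)"
proof (induction c)
  case 0
  show ?case by (rule recursiveI) (rule rec_eval.Zero)
qed (rule recursive_Suc)

lemma recursive_add:
  assumes "recursive n F" and "recursive n G"
  shows "recursive n (\<lambda>xs. F xs + G xs)"
proof -
  have "rec_nat a (\<lambda>m y. Suc y) b = a + b" for a b :: nat
    by (induction b) auto
  then show ?thesis
    using recursive_rec_nat[OF assms(1) _ assms(2), of "\<lambda>zs. Suc (zs ! 1)"]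
    by (simp add: recursive_Suc recursive_nth)
qed

lemma recursive_diff:
  assumes "recursive n F" and "recursive n G"
  shows "recursive n (\<lambda>xs. F xs - G xs)"
proof -
  have "rec_nat 0 (\<lambda>m y. m) x = x - 1" for x :: nat
    by (cases x) auto
  then have pred: "recursive k (\<lambda>xs. H xs - 1)" if "recursive k H" for k H
    using recursive_rec_nat[OF recursive_const[of k 0] _ that, of "\<lambda>zs. zs ! 0"]
    by (simp add: recursive_nth)
  have "rec_nat a (\<lambda>m y. y - 1) b = a - b" for a b :: nat
    by (induction b) auto
  then show ?thesis
    using recursive_rec_nat[OF assms(1) pred[OF recursive_nth[of 1]] assms(2)] by simp
qed

lemma recursive_if_eq:
  assumes "recursive n F" "recursive n G" "recursive n A" "recursive n B"
  shows "recursive n (\<lambda>xs. if F xs = G xs then A xs else B xs)"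
proof -
  (* Recursion on the distance of the two values: its first step already yields the else-branch. *)
  have "rec_nat a (\<lambda>m y. b) ((p - q) + (q - p)) = (if p = q then a else b)" for a b p q :: nat
    by (cases "(p - q) + (q - p)") auto
  then show ?thesis
    using recursive_rec_nat[OF assms(3) recursive_drop[OF assms(4), of 2]
        recursive_add[OF recursive_diff[OF assms(1,2)] recursive_diff[OF assms(2,1)]]]
    by (simp add: numeral_2_eq_2)
qed

section \<open>Injective enumerations\<close>

text \<open>
  The enumeration is thinned out to the positions at which a new value appears. Searching from one
  such position for the next never fails, as the range is infinite, and it skips no value, as the
  least suitable position is taken.
\<close>

lemma injective_enumeration:
  assumes f: "computable f" and inf: "infinite (range f)"
  obtains g where "computable g" and "inj g" and "range g = range f"
proof -
  define idx where "idx = rec_nat 0 (\<lambda>m p. LEAST k. f k \<notin> f ` {..p})"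
  have idx_0: "idx 0 = 0"
    and idx_Suc: "idx (Suc n) = (LEAST k. f k \<notin> f ` {..idx n})" for n
    by (simp_all add: idx_def)
  have fresh: "\<exists>k. f k \<notin> f ` {..p}" for p
    using inf by (metis finite_atMost finite_imageI finite_subset image_subsetI)
  have new: "f (idx (Suc n)) \<notin> f ` {..idx n}" for n
    unfolding idx_Suc by (rule LeastI_ex) (rule fresh)
  have old: "f k \<in> f ` {..idx n}" if "k < idx (Suc n)" for k n
    using not_less_Least that unfolding idx_Suc by blast
  have "idx n < idx (Suc n)" for n
    using new[of n] by (metis atMost_iff image_eqI not_le)
  then have mono: "strict_mono idx"
    by (simp add: strict_mono_Suc_iff)
  have "f (idx m) \<noteq> f (idx n)" if less: "m < n" for m n
  proof -
    obtain l where n: "n = Suc l" using less by (cases n) auto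
    with less have "idx m \<le> idx l" using mono by (simp add: strict_mono_less_eq)
    then have "f (idx m) \<in> f ` {..idx l}" by simp
    with new[of l] show ?thesis unfolding n by metis
  qed
  then have inj: "inj (\<lambda>n. f (idx n))"
    by (metis injI linorder_neqE_nat)
  have covered: "f ` {..idx n} \<subseteq> range (\<lambda>n. f (idx n))" for n
  proof (induction n)
    case 0
    show ?case by (auto simp: idx_0) (metis idx_0 rangeI)
  next
    case (Suc n)
    have "{..idx (Suc n)} = insert (idx (Suc n)) {..<idx (Suc n)}" by auto
    then show ?case using old[of _ n] Suc by auto
  qed
  have "f j \<in> range (\<lambda>n. f (idx n))" for j
    using covered[of j] strict_mono_imp_increasing[OF mono, of j] by blast
  then have range: "range (\<lambda>n. f (idx n)) = range f" by auto

  have f_rec: "recursive n H \<Longrightarrow> recursive n (\<lambda>xs. f (H xs))" for n H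
    using f by (rule recursive_computable)
  (* The condition in the search for the next position is decidable, by recursion over the finitely
     many earlier positions; hence the search is an instance of minimization. *)
  define seen where "seen = (\<lambda>p k. rec_nat 0 (\<lambda>j y. if f j = f k then Suc 0 else y) (Suc p) :: nat)"
  have "rec_nat 0 (\<lambda>j y. if f j = f k then Suc 0 else y) m = (0::nat) \<longleftrightarrow> f k \<notin> f ` {..<m}" for k m
    by (induction m) (auto simp: lessThan_Suc)
  then have seen_iff: "seen p k = 0 \<longleftrightarrow> f k \<notin> f ` {..p}" for p k
    unfolding seen_def lessThan_Suc_atMost[symmetric] .
  have "recursive (Suc n) (\<lambda>xs. seen (H (tl xs)) (xs ! 0))" if "recursive n H" for n H
  proof -
    have "recursive (Suc n) (\<lambda>xs. H (drop 1 xs))"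
      using recursive_drop[OF that, of 1] by simp
    then have "recursive (Suc n) (\<lambda>xs. rec_nat 0
        (\<lambda>j y. (\<lambda>zs. if f (zs ! 0) = f (zs ! 2) then Suc 0 else zs ! 1) (j # y # xs)) (Suc (H (drop 1 xs))))"
      by (intro recursive_rec_nat recursive_const recursive_Suc recursive_if_eq f_rec recursive_nth)
        auto
    then show ?thesis by (simp add: seen_def drop_Suc numeral_2_eq_2 cong: if_cong)
  qed
  then have "recursive n (\<lambda>xs. LEAST k. seen (H (tl (k # xs))) ((k # xs) ! 0) = 0)"
    if "recursive n H" for n H
    using that fresh by (intro recursive_Least) (auto simp: seen_iff)
  then have step: "recursive n (\<lambda>xs. LEAST k. f k \<notin> f ` {..H xs})" if "recursive n H" for n H
    using that by (simp add: seen_iff)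
  have "recursive 1 (\<lambda>xs. rec_nat 0
      (\<lambda>m y. (\<lambda>zs. LEAST k. f k \<notin> f ` {..zs ! 1}) (m # y # xs)) (xs ! 0))"
    by (intro recursive_rec_nat recursive_const step recursive_nth) auto
  then have "recursive 1 (\<lambda>xs. f (idx (xs ! 0)))"
    by (intro f_rec) (simp add: idx_def)
  then have "computable (\<lambda>n. f (idx n))"
    by (simp add: computable_iff_recursive)
  with inj range show thesis by (rule that[rotated])
qed

section \<open>Names of bounded multiplicity\<close>

definition bounded_name :: "real \<Rightarrow> bool" where
  "bounded_name x \<longleftrightarrow>
     (\<exists>f c. computable f \<and> is_name f x \<and> (\<forall>n. multiplicity_fun f n \<le> c))"

lemma inj_multiplicity_le_1:
  assumes "inj f"
  shows "multiplicity_fun f n \<le> 1"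
proof -
  have "{k. f k = n} = {} \<or> (\<exists>a. {k. f k = n} = {a})"
    using assms by (auto dest: injD)
  then show ?thesis unfolding multiplicity_fun_def by auto
qed

text \<open>
  The series is dominated by a geometric one, so the bound \<open>c\<close> alone determines a modulus of
  convergence, whether or not \<open>u\<close> is computable.
\<close>

lemma multiplicity_series_converges_computably:
  assumes u: "\<And>n. u n \<le> c"
  shows "series_converges_computably (\<lambda>k. real (u k) * (1 / 2 ^ k))"
proof -
  define a where "a = (\<lambda>k. real (u k) * (1 / 2 ^ k))"
  have bound: "a k \<le> real c * (1 / 2) ^ k" and nonneg: "0 \<le> a k" for k
    using u[of k] by (auto simp: a_def power_divide divide_right_mono)
  have "summable (\<lambda>k. real c * (1 / 2) ^ k)"
    by (intro summable_mult summable_geometric) simp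
  then have summable: "summable a"
    by (rule summable_comparison_test') (use bound nonneg in simp)
  have tail: "\<bar>suminf a - (\<Sum>i<k. a i)\<bar> \<le> 1 / 2 ^ n" if k: "n + (c + 1) \<le> k" for n k
  proof -
    have shift: "summable (\<lambda>i. a (i + k))" using summable by (simp add: summable_iff_shift)
    have "suminf a - (\<Sum>i<k. a i) = (\<Sum>i. a (i + k))"
      using suminf_minus_initial_segment[OF summable, of k] by simp
    moreover have "0 \<le> (\<Sum>i. a (i + k))"
      using shift nonneg by (intro suminf_nonneg) auto
    moreover have "(\<Sum>i. a (i + k)) \<le> (\<Sum>i. real c / 2 ^ k * (1 / 2) ^ i)"
    proof (rule suminf_le)
      show "a (i + k) \<le> real c / 2 ^ k * (1 / 2) ^ i" for i
        using bound[of "i + k"] by (simp add: power_add power_divide field_simps)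
    qed (use shift in \<open>auto intro!: summable_mult summable_geometric\<close>)
    moreover have "(\<Sum>i. real c / 2 ^ k * (1 / 2) ^ i) = real c / 2 ^ k * 2"
      by (subst suminf_mult) (auto simp: suminf_geometric intro!: summable_geometric)
    (* The offset c + 1 in the modulus absorbs the factor 2 * c, as c \<le> 2 ^ c. *)
    moreover have "real c / 2 ^ k * 2 \<le> 1 / 2 ^ n"
    proof -
      have "real c \<le> 2 ^ c"
        using of_nat_mono[OF less_imp_le[OF less_exp[of c]], where 'a = real] by simp
      then have "real c * 2 * 2 ^ n \<le> 2 ^ (n + (c + 1))"
        by (simp add: power_add)
      also have "\<dots> \<le> 2 ^ k"
        using k by (intro power_increasing) auto
      finally show ?thesis by (simp add: field_simps)
    qed
    ultimately show ?thesis by linarith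
  qed
  have "computable (\<lambda>n. n + (c + 1))"
    unfolding computable_iff_recursive
    by (intro recursive_add recursive_nth recursive_const) simp
  moreover have "(\<lambda>n. \<Sum>k<n. a k) \<longlonglongrightarrow> suminf a"
    using summable by (rule summable_LIMSEQ)
  ultimately have "series_converges_computably a"
    unfolding series_converges_computably_def converges_computably_def
    using tail by (intro exI[of _ "suminf a"] conjI exI[of _ "\<lambda>n. n + (c + 1)"]) auto
  then show ?thesis by (simp only: a_def)
qed

lemma bounded_name_imp_reordered_computable: "bounded_name x \<Longrightarrow> reordered_computable x"
  unfolding bounded_name_def reordered_computable_def
  using multiplicity_series_converges_computably by blast

text \<open>
  The terms are positive, so the order of summation is irrelevant. The unordered sum can be split
  along the even and odd numbers and carried over along an injective enumeration.
\<close>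

lemma is_name_iff_has_sum: "is_name f x \<longleftrightarrow> ((\<lambda>k. 1 / 2 ^ f k) has_sum x) UNIV"
  unfolding is_name_def by (auto intro: has_sum_imp_sums sums_nonneg_imp_has_sum)

definition interleave :: "(nat \<Rightarrow> nat) \<Rightarrow> (nat \<Rightarrow> nat) \<Rightarrow> nat \<Rightarrow> nat" where
  "interleave f g k = (if k mod 2 = 0 then f (k div 2) else g (k div 2))"

lemma computable_interleave:
  assumes f: "computable f" and g: "computable g"
  shows "computable (interleave f g)"
proof -
  have "rec_nat 0 (\<lambda>m y. 1 - y) k = k mod 2" for k :: nat
    by (induction k) (auto simp: mod_Suc)
  then have mod2: "recursive n (\<lambda>xs. H xs mod 2)" if "recursive n H" for n H
    using recursive_rec_nat[OF recursive_const[of n 0]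
        recursive_diff[OF recursive_const[of _ 1] recursive_nth[of 1]] that] by simp
  have "rec_nat 0 (\<lambda>m y. y + m mod 2) k = k div 2" for k :: nat
    by (induction k) (simp_all, presburger)
  then have div2: "recursive n (\<lambda>xs. H xs div 2)" if "recursive n H" for n H
    using recursive_rec_nat[OF recursive_const[of n 0]
        recursive_add[OF recursive_nth[of 1] mod2[OF recursive_nth[of 0]]] that] by simp
  show ?thesis
    unfolding computable_iff_recursive interleave_def
    by (intro recursive_if_eq recursive_computable[OF f] recursive_computable[OF g]
        recursive_const mod2 div2 recursive_nth) auto
qed

lemma UNIV_nat_even_odd: "(UNIV :: nat set) = range (\<lambda>k. 2 * k) \<union> range (\<lambda>k. 2 * k + 1)"
  by (auto simp: image_iff) presburger

lemma bounded_name_add: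
  assumes "bounded_name x" and "bounded_name y"
  shows "bounded_name (x + y)"
proof -
  from assms obtain f g c d where f: "computable f" "is_name f x" "\<And>n. multiplicity_fun f n \<le> c"
    and g: "computable g" "is_name g y" "\<And>n. multiplicity_fun g n \<le> d"
    unfolding bounded_name_def by blast
  let ?h = "interleave f g"
  let ?ev = "\<lambda>k::nat. 2 * k" and ?od = "\<lambda>k::nat. 2 * k + 1"
  have ev: "?h (2 * k) = f k" and od: "?h (2 * k + 1) = g k" for k
    by (simp_all add: interleave_def)
  have inj: "inj ?ev" "inj ?od"
    by (auto simp: inj_def)
  have "((\<lambda>k. 1 / 2 ^ ?h k :: real) has_sum x) (range ?ev)"
    using f(2) by (subst has_sum_reindex[OF inj(1)]) (simp only: comp_def ev is_name_iff_has_sum)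
  moreover have "((\<lambda>k. 1 / 2 ^ ?h k :: real) has_sum y) (range ?od)"
    using g(2) by (subst has_sum_reindex[OF inj(2)]) (simp only: comp_def od is_name_iff_has_sum)
  moreover have "range ?ev \<inter> range ?od = {}"
    by auto presburger
  ultimately have "((\<lambda>k. 1 / 2 ^ ?h k :: real) has_sum (x + y)) (range ?ev \<union> range ?od)"
    by (rule has_sum_Un_disjoint)
  then have "is_name ?h (x + y)"
    by (simp only: is_name_iff_has_sum UNIV_nat_even_odd[symmetric])
  moreover have "multiplicity_fun ?h n \<le> c + d" for n
  proof -
    have "{k. ?h k = n} = ?ev ` {k. f k = n} \<union> ?od ` {k. g k = n}"
    proof -
      have "{k. ?h k = n} = {k \<in> range ?ev \<union> range ?od. ?h k = n}"
        using UNIV_nat_even_odd by blast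
      also have "\<dots> = ?ev ` {k. f k = n} \<union> ?od ` {k. g k = n}"
        using ev od by auto
      finally show ?thesis .
    qed
    then have "multiplicity_fun ?h n \<le> card (?ev ` {k. f k = n}) + card (?od ` {k. g k = n})"
      unfolding multiplicity_fun_def by (metis card_Un_le)
    also have "\<dots> = multiplicity_fun f n + multiplicity_fun g n"
      unfolding multiplicity_fun_def
      by (intro arg_cong2[of _ _ _ _ "(+)"] card_image inj_on_subset[OF inj(1)]
          inj_on_subset[OF inj(2)]) auto
    also have "\<dots> \<le> c + d" by (intro add_mono f g)
    finally show ?thesis .
  qed
  ultimately show ?thesis
    unfolding bounded_name_def using computable_interleave[OF f(1) g(1)] by blast
qed

lemma bounded_name_inverse_power_2: "bounded_name (1 / 2 ^ n)"
proof -
  let ?f = "\<lambda>k. k + Suc n"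
  have "computable ?f"
    unfolding computable_iff_recursive
    by (intro recursive_add recursive_nth recursive_const) simp
  moreover have "is_name ?f (1 / 2 ^ n)"
    using sums_mult[OF power_half_series, of "1 / 2 ^ n"]
    by (simp add: is_name_def power_add power_divide field_simps)
  moreover have "multiplicity_fun ?f m \<le> 1" for m
    by (rule inj_multiplicity_le_1) (simp add: inj_def)
  ultimately show ?thesis
    unfolding bounded_name_def by blast
qed

section \<open>Regular numbers\<close>

text \<open>
  The case of \<open>0\<close> is carried along because single summands, and empty sums, may vanish, and \<open>0\<close> has
  no name.
\<close>

lemma zero_or_bounded_name_add:
  "x = 0 \<or> bounded_name x \<Longrightarrow> y = 0 \<or> bounded_name y \<Longrightarrow> x + y = 0 \<or> bounded_name (x + y)"
  by (auto intro: bounded_name_add)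

lemma zero_or_bounded_name_sum_list:
  "(\<And>y. y \<in> set ys \<Longrightarrow> y = 0 \<or> bounded_name y) \<Longrightarrow> sum_list ys = 0 \<or> bounded_name (sum_list ys)"
proof (induction ys)
  case (Cons y ys)
  then show ?case using zero_or_bounded_name_add[of y "sum_list ys"] by simp
qed simp

lemma zero_or_bounded_name_sum:
  "(\<And>i. i \<in> A \<Longrightarrow> h i = 0 \<or> bounded_name (h i)) \<Longrightarrow> sum h A = 0 \<or> bounded_name (sum h A)"
proof (induction A rule: infinite_finite_induct)
  case (insert i A)
  then show ?case using zero_or_bounded_name_add[of "h i" "sum h A"] by simp
qed simp_all

lemma strongly_left_computable_zero_or_bounded_name:
  assumes "strongly_left_computable y"
  shows "y = 0 \<or> bounded_name y"
proof -
  from assms obtain A where ce: "computably_enumerable A"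
    and y: "((\<lambda>n. 1 / 2 ^ (n + 1)) has_sum y) A"
    unfolding strongly_left_computable_def by blast
  show ?thesis
  proof (cases "finite A")
    case True
    with y have "y = (\<Sum>n\<in>A. 1 / 2 ^ (n + 1))"
      by (simp only: has_sum_finite_iff)
    then show ?thesis
      using zero_or_bounded_name_sum[of A "\<lambda>n. 1 / 2 ^ (n + 1)"] bounded_name_inverse_power_2
      by blast
  next
    case False
    with ce obtain f where "computable f" and A: "A = range f"
      unfolding computably_enumerable_def by auto
    with False obtain g where g: "computable g" "inj g" "range g = range f"
      using injective_enumeration by metis
    have "((\<lambda>k. 1 / 2 ^ (Suc (g k)) :: real) has_sum y) UNIV"
      using y unfolding A g(3)[symmetric] has_sum_reindex[OF g(2)] by (simp add: comp_def)
    then have "is_name (\<lambda>k. Suc (g k)) y"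
      by (simp only: is_name_iff_has_sum)
    moreover have "computable (\<lambda>k. Suc (g k))"
      unfolding computable_iff_recursive
      by (intro recursive_Suc recursive_computable[OF g(1)] recursive_nth) simp
    moreover have "multiplicity_fun (\<lambda>k. Suc (g k)) n \<le> 1" for n
      using g(2) by (intro inj_multiplicity_le_1) (simp add: inj_def)
    ultimately show ?thesis
      unfolding bounded_name_def by blast
  qed
qed

theorem proposition10:
  fixes x :: real
  assumes "regular_real x" and "x > 0"
  shows "reordered_computable x"
proof -
  from assms(1) obtain ys where "\<forall>y\<in>set ys. strongly_left_computable y" and x: "x = sum_list ys"
    unfolding regular_real_def by blast
  then have "x = 0 \<or> bounded_name x"
    using zero_or_bounded_name_sum_list strongly_left_computable_zero_or_bounded_name by blast
  with assms(2) show ?thesis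
    using bounded_name_imp_reordered_computable by auto
qed

end
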